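(* Let $(V,\nu,\tau,\tau^* )$ be a PN space and suppose that $\tau$ and $\tau^*$ are sup-continuous. Let $W$ be a linear subspace of $V$, and let $V/\!\sim_W$ be the quotient of $V$ by the equivalence relation $p\sim_W q \Leftrightarrow p-q\in W$. Let $\nu'$ be the restriction of $\nu$ to $W$, and define $\bar\nu: V/\!\sim_W\to\Delta^+$ by $$\bar\nu_{p+W}(x):=\sup_{q\in W}\nu_{p+q}(x)\qquad (p\in V).$$ Then $(W,\nu',\tau,\tau^* )$ is a PN space and $(V/\!\sim_W,\bar\nu,\tau,\tau^* )$ is a PPN space.
   Context: Linear spaces are real. $\Delta^+$ is the set of functions $F:\mathbb{R}\cup\{-\infty,+\infty\}\to[0,1]$ that are non-decreasing, left-continuous on $\mathbb{R}$, with $F(-\infty)=F(0)=0$ and $F(+\infty)=1$; it is ordered pointwise. $\varepsilon_0\in\Delta^+$ is given by $\varepsilon_0(x)=0$ for $x\le 0$ and $\varepsilon_0(x)=1$ for $x>0$. $\Delta^+$ carries the Sibley metric $d_S(F,G)=\inf\{h>0: (F,G;h)\text{ and }(G,F;h)\text{ hold}\}$, where, for $h\in(0,1]$, $(F,G;h)$ is the condition $F(x-h)-h\le G(x)\le F(x+h)+h$ for all $x\in(-1/h,1/h)$. A triangle function is an associative, commutative binary operation on $\Delta^+$, non-decreasing in each place, with identity $\varepsilon_0$; its continuity is with respect to $d_S$. A triangle function $\tau$ is sup-continuous if for every family $\{F_\lambda\}_{\lambda\in\Lambda}$ in $\Delta^+$ and every $G\in\Delta^+$, $\sup_\lambda\tau(F_\lambda,G)=\tau(\sup_\lambda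 F_\lambda,G)$ (pointwise suprema). A probabilistic normed (PN) space is a quadruple $(V,\nu,\tau,\tau^* )$ where $V$ is a linear space, $\tau,\tau^*$ are continuous triangle functions with $\tau\le\tau^*$, and $\nu:V\to\Delta^+$, $p\mapsto\nu_p$, satisfies: (N1) $\nu_p=\varepsilon_0$ iff $p=\theta$ (the null vector); (N2) $\nu_{-p}=\nu_p$; (N3) $\nu_{p+q}\ge\tau(\nu_p,\nu_q)$; (N4) $\nu_p\le\tau^*(\nu_{\alpha p},\nu_{(1-\alpha)p})$ for every $\alpha\in[0,1]$; for all $p,q\in V$. A probabilistic pseudo normed (PPN) space is defined in the same way with (N1) replaced by the single requirement $\nu_\theta=\varepsilon_0$. *)

theory Defs
  imports "HOL-Analysis.Analysis" "HOL-Algebra.Module"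
begin

section \<open>The space of distance distribution functions\<close>

typedef ddf =
  "{F :: ereal \<Rightarrow> real. range F \<subseteq> {0..1} \<and> mono F \<and>
      (\<forall>x :: real. continuous (at_left x) (\<lambda>y. F (ereal y))) \<and>
      F (-\<infinity>) = 0 \<and> F 0 = 0 \<and> F \<infinity> = 1}"
proof
  let ?F = "\<lambda>x :: ereal. if x = \<infinity> then 1 else (0 :: real)"
  show "?F \<in> {F :: ereal \<Rightarrow> real. range F \<subseteq> {0..1} \<and> mono F \<and>
      (\<forall>x :: real. continuous (at_left x) (\<lambda>y. F (ereal y))) \<and>
      F (-\<infinity>) = 0 \<and> F 0 = 0 \<and> F \<infinity> = 1}"
    by (auto simp: mono_def)
qed

setup_lifting type_definition_ddf

lemma Rep_ddf_props:
  shows Rep_ddf_ge0: "0 \<le> Rep_ddf F x" and Rep_ddf_le1: "Rep_ddf F x \<le> 1"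
    and Rep_ddf_mono: "x \<le> y \<Longrightarrow> Rep_ddf F x \<le> Rep_ddf F y"
    and Rep_ddf_left: "continuous (at_left r) (\<lambda>y. Rep_ddf F (ereal y))"
    and Rep_ddf_minf: "Rep_ddf F (-\<infinity>) = 0" and Rep_ddf_0: "Rep_ddf F 0 = 0"
    and Rep_ddf_inf: "Rep_ddf F \<infinity> = 1"
  using Rep_ddf[of F] by (auto simp: mono_def image_subset_iff)

lift_definition eps0 :: ddf is "\<lambda>x. if x \<le> 0 then 0 else 1"
proof -
  let ?F = "\<lambda>x :: ereal. if x \<le> 0 then 0 else (1 :: real)"
  have "continuous (at_left x) (\<lambda>y. ?F (ereal y))" for x :: real
  proof (cases "x \<le> 0")
    case True
    have "eventually (\<lambda>y. ?F (ereal y) = 0) (at_left x)"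
      using True by (auto simp: eventually_at_filter)
    then show ?thesis
      using True by (simp add: continuous_within tendsto_eventually)
  next
    case False
    then have "eventually (\<lambda>y. y > 0) (at_left x)"
      by (auto simp: eventually_at_left[of 0] intro: exI[of _ 0])
    then have "eventually (\<lambda>y. ?F (ereal y) = 1) (at_left x)"
      by eventually_elim auto
    then show ?thesis
      using False by (simp add: continuous_within tendsto_eventually)
  qed
  then show "range ?F \<subseteq> {0..1} \<and> mono ?F \<and>
      (\<forall>x :: real. continuous (at_left x) (\<lambda>y. ?F (ereal y))) \<and>
      ?F (-\<infinity>) = 0 \<and> ?F 0 = 0 \<and> ?F \<infinity> = 1"
    by (auto simp: mono_def)
qed

instantiation ddf :: order
begin

definition less_eq_ddf :: "ddf \<Rightarrow> ddf \<Rightarrow> bool"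
  where "F \<le> G \<longleftrightarrow> (\<forall>x. Rep_ddf F x \<le> Rep_ddf G x)"

definition less_ddf :: "ddf \<Rightarrow> ddf \<Rightarrow> bool"
  where "F < G \<longleftrightarrow> F \<le> G \<and> \<not> G \<le> (F :: ddf)"

instance
proof
  fix F G H :: ddf
  show "F < G \<longleftrightarrow> F \<le> G \<and> \<not> G \<le> F" by (rule less_ddf_def)
  show "F \<le> F" by (simp add: less_eq_ddf_def)
  show "F \<le> H" if "F \<le> G" "G \<le> H"
    using that unfolding less_eq_ddf_def by (meson order_trans)
  show "F = G" if "F \<le> G" "G \<le> F"
  proof -
    have "Rep_ddf F = Rep_ddf G"
      using that unfolding less_eq_ddf_def by (intro ext order.antisym) blast+
    then show ?thesis by (simp add: Rep_ddf_inject)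
  qed
qed

end

text \<open>Suprema are pointwise. The value at the empty set is unspecified: the pointwise
  supremum of an empty family would not take the value 1 at \<open>\<infinity>\<close>.\<close>

instantiation ddf :: Sup
begin

definition Sup_ddf :: "ddf set \<Rightarrow> ddf"
  where "Sup S = Abs_ddf (\<lambda>x. SUP F\<in>S. Rep_ddf F x)"

instance ..

end

lemma bdd_above_Rep_ddf: "bdd_above ((\<lambda>F. Rep_ddf F x) ` S)"
  by (auto simp: bdd_above_def intro!: exI[of _ 1] Rep_ddf_le1)

lemma Rep_ddf_Sup:
  assumes "S \<noteq> {}"
  shows "Rep_ddf (Sup S) x = (SUP F\<in>S. Rep_ddf F x)"
proof -
  let ?f = "\<lambda>x. SUP F\<in>S. Rep_ddf F x"
  have upper: "Rep_ddf F x \<le> ?f x" if "F \<in> S" for F x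
    using that by (intro cSUP_upper bdd_above_Rep_ddf)
  have f_mono: "?f x \<le> ?f y" if "x \<le> y" for x y
    using assms that by (intro cSUP_least) (auto intro: order_trans[OF Rep_ddf_mono upper])
  have f_01: "0 \<le> ?f x \<and> ?f x \<le> 1" for x
  proof
    obtain F where "F \<in> S" using assms by blast
    then show "0 \<le> ?f x" using Rep_ddf_ge0 upper order_trans by blast
    show "?f x \<le> 1" using assms by (intro cSUP_least Rep_ddf_le1)
  qed
  have "continuous (at_left r) (\<lambda>y. ?f (ereal y))" for r :: real
    unfolding continuous_within
  proof (rule order_tendstoI)
    fix a assume "a < ?f (ereal r)"
    then obtain F where F: "F \<in> S" "a < Rep_ddf F (ereal r)"
      using assms by (auto simp: less_cSUP_iff bdd_above_Rep_ddf)
    have "((\<lambda>y. Rep_ddf F (ereal y)) \<longlongrightarrow> Rep_ddf F (ereal r)) (at_left r)"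
      using Rep_ddf_left[of r F] by (simp add: continuous_within)
    then have "\<forall>\<^sub>F y in at_left r. a < Rep_ddf F (ereal y)"
      using F(2) by (rule order_tendstoD)
    then show "\<forall>\<^sub>F y in at_left r. a < ?f (ereal y)"
      by eventually_elim (use upper[OF F(1)] in \<open>auto intro: less_le_trans\<close>)
  next
    fix a assume a: "?f (ereal r) < a"
    have "\<forall>\<^sub>F y in at_left r. y < r"
      by (auto simp: eventually_at_filter)
    then show "\<forall>\<^sub>F y in at_left r. ?f (ereal y) < a"
      by eventually_elim (rule le_less_trans[OF f_mono a], simp)
  qed
  then have "?f \<in> {F :: ereal \<Rightarrow> real. range F \<subseteq> {0..1} \<and> mono F \<and>
      (\<forall>x :: real. continuous (at_left x) (\<lambda>y. F (ereal y))) \<and>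
      F (-\<infinity>) = 0 \<and> F 0 = 0 \<and> F \<infinity> = 1}"
    using assms f_01 f_mono
    by (auto simp: mono_def Rep_ddf_minf Rep_ddf_0 Rep_ddf_inf)
  then show ?thesis
    by (simp add: Sup_ddf_def Abs_ddf_inverse)
qed

section \<open>The Sibley metric\<close>

definition sibley_cond :: "ddf \<Rightarrow> ddf \<Rightarrow> real \<Rightarrow> bool"
  where "sibley_cond F G h \<longleftrightarrow>
    (\<forall>x \<in> {-1/h<..<1/h}.
      Rep_ddf F (ereal (x - h)) - h \<le> Rep_ddf G (ereal x) \<and>
      Rep_ddf G (ereal x) \<le> Rep_ddf F (ereal (x + h)) + h)"

definition sibley_set :: "ddf \<Rightarrow> ddf \<Rightarrow> real set"
  where "sibley_set F G = {h. 0 < h \<and> h \<le> 1 \<and> sibley_cond F G h \<and> sibley_cond G F h}"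

definition sibley_dist :: "ddf \<Rightarrow> ddf \<Rightarrow> real"
  where "sibley_dist F G = Inf (sibley_set F G)"

lemma sibley_set_1: "1 \<in> sibley_set F G"
proof -
  have "Rep_ddf F x - 1 \<le> Rep_ddf G y \<and> Rep_ddf G y \<le> Rep_ddf F x + 1" for F G x y
    using Rep_ddf_le1[of F x] Rep_ddf_ge0[of G y] Rep_ddf_le1[of G y] Rep_ddf_ge0[of F x]
    by linarith
  then have "sibley_cond F G 1" for F G unfolding sibley_cond_def by blast
  then show ?thesis by (simp add: sibley_set_def)
qed

lemma bdd_below_sibley_set: "bdd_below (sibley_set F G)"
  by (rule bdd_belowI[of _ 0]) (simp add: sibley_set_def)

lemma sibley_dist_le: "h \<in> sibley_set F G \<Longrightarrow> sibley_dist F G \<le> h"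
  unfolding sibley_dist_def by (rule cInf_lower[OF _ bdd_below_sibley_set])

lemma sibley_dist_ge0: "0 \<le> sibley_dist F G"
  unfolding sibley_dist_def
proof (rule cInf_greatest)
  show "sibley_set F G \<noteq> {}" using sibley_set_1 by blast
qed (simp add: sibley_set_def)

lemma sibley_dist_less:
  assumes "sibley_dist F G < e" obtains h where "h \<in> sibley_set F G" "h < e"
proof -
  have "\<exists>h\<in>sibley_set F G. h < e"
    using assms cInf_less_iff[OF _ bdd_below_sibley_set, of F G e] sibley_set_1[of F G]
    unfolding sibley_dist_def by blast
  then show thesis using that by blast
qed

lemma sibley_dist_commute: "sibley_dist F G = sibley_dist G F"
  by (simp add: sibley_dist_def sibley_set_def conj_commute)

lemma sibley_cond_trans:
  assumes h: "0 < h" and k: "0 < k" and hk: "h + k \<le> 1"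
    and FG: "sibley_cond F G h" and GH: "sibley_cond G H k"
  shows "sibley_cond F H (h + k)"
  unfolding sibley_cond_def
proof
  fix x assume x: "x \<in> {-1/(h+k)<..<1/(h+k)}"
  have pos: "0 < h + k" using h k by simp
  have "h * (h + k) \<le> 1"
    using h k hk by (intro mult_le_one) auto
  then have "k * (h * (h + k)) \<le> k * 1"
    using k by (intro mult_left_mono) auto
  then have "k \<le> k / (h * (h + k))"
    using h pos by (simp add: le_divide_eq)
  moreover have "1/h - 1/(h+k) = k / (h * (h + k))"
    using h pos by (simp add: field_simps)
  ultimately have 1: "1/(h+k) + k \<le> 1/h" by linarith
  have 2: "1/(h+k) \<le> 1/k" using h k by (simp add: frac_le)
  have xk: "x \<in> {-1/k<..<1/k}" and xh: "x - k \<in> {-1/h<..<1/h}" "x + k \<in> {-1/h<..<1/h}"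
    using x 1 2 k by auto
  have "Rep_ddf F (ereal (x - k - h)) - h \<le> Rep_ddf G (ereal (x - k))"
    "Rep_ddf G (ereal (x - k)) - k \<le> Rep_ddf H (ereal x)"
    "Rep_ddf H (ereal x) \<le> Rep_ddf G (ereal (x + k)) + k"
    "Rep_ddf G (ereal (x + k)) \<le> Rep_ddf F (ereal (x + k + h)) + h"
    using FG GH xk xh unfolding sibley_cond_def by blast+
  then show "Rep_ddf F (ereal (x - (h + k))) - (h + k) \<le> Rep_ddf H (ereal x) \<and>
      Rep_ddf H (ereal x) \<le> Rep_ddf F (ereal (x + (h + k))) + (h + k)"
    by (simp add: algebra_simps)
qed

lemma sibley_dist_triangle: "sibley_dist F H \<le> sibley_dist F G + sibley_dist G H"
proof (rule field_le_epsilon)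
  fix e :: real assume "0 < e"
  obtain h where h: "h \<in> sibley_set F G" "h < sibley_dist F G + e/2"
    using \<open>0 < e\<close> by (rule_tac sibley_dist_less[of F G "sibley_dist F G + e/2"]) auto
  obtain k where k: "k \<in> sibley_set G H" "k < sibley_dist G H + e/2"
    using \<open>0 < e\<close> by (rule_tac sibley_dist_less[of G H "sibley_dist G H + e/2"]) auto
  have "sibley_dist F H \<le> h + k"
  proof (cases "h + k \<le> 1")
    case True
    have hk: "0 < h" "0 < k" "k + h \<le> 1" "sibley_cond F G h" "sibley_cond G F h"
      "sibley_cond G H k" "sibley_cond H G k"
      using h(1) k(1) True by (auto simp: sibley_set_def)
    have "sibley_cond F H (h + k)"
      using hk(1,2) True hk(4,6) by (rule sibley_cond_trans)
    moreover have "sibley_cond H F (k + h)"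
      using hk(2,1,3,7,5) by (rule sibley_cond_trans)
    ultimately have "h + k \<in> sibley_set F H"
      using hk(1,2) True by (simp add: sibley_set_def add.commute[of k h])
    then show ?thesis by (rule sibley_dist_le)
  next
    case False
    then show ?thesis using sibley_dist_le[OF sibley_set_1, of F H] by simp
  qed
  then show "sibley_dist F H \<le> sibley_dist F G + sibley_dist G H + e"
    using h(2) k(2) by simp
qed

lemma sibley_dist_0_le:
  assumes "sibley_dist F G = 0" shows "Rep_ddf F x \<le> Rep_ddf G x"
proof (cases x)
  case (real r)
  show ?thesis
  proof (rule ccontr)
    assume "\<not> ?thesis"
    then have less: "Rep_ddf G x < Rep_ddf F x" by simp
    define e where "e = Rep_ddf F x - Rep_ddf G x"
    have e: "0 < e" using less by (simp add: e_def)
    have "((\<lambda>y. Rep_ddf F (ereal y)) \<longlongrightarrow> Rep_ddf F (ereal r)) (at_left r)"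
      using Rep_ddf_left[of r F] by (simp add: continuous_within)
    then have "\<forall>\<^sub>F y in at_left r. Rep_ddf F x - e/2 < Rep_ddf F (ereal y)"
      using e real by (intro order_tendstoD) auto
    then obtain b where b: "b < r" "\<And>y. b < y \<Longrightarrow> y < r \<Longrightarrow> Rep_ddf F x - e/2 < Rep_ddf F (ereal y)"
      by (auto simp: eventually_at_left[of "r - 1"])
    define m where "m = min (r - b) (min (e/2) (1 / (\<bar>r\<bar> + 1)))"
    have "sibley_dist F G < m" using assms b e by (simp add: m_def)
    then obtain h where h: "h \<in> sibley_set F G" "h < m" by (rule sibley_dist_less)
    have h0: "0 < h" and FG: "sibley_cond F G h" using h(1) by (auto simp: sibley_set_def)
    have hm: "h < r - b" "h < e/2" "h < 1 / (\<bar>r\<bar> + 1)" using h(2) by (auto simp: m_def)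
    have "\<bar>r\<bar> + 1 < 1/h" using hm(3) h0 by (simp add: field_simps)
    then have "r \<in> {-1/h<..<1/h}" by (auto simp: abs_if split: if_splits)
    then have "Rep_ddf F (ereal (r - h)) - h \<le> Rep_ddf G (ereal r)"
      using FG unfolding sibley_cond_def by blast
    moreover have "Rep_ddf F x - e/2 < Rep_ddf F (ereal (r - h))"
      using hm h0 by (intro b) auto
    moreover have False if "c - h \<le> b" "a - e/2 < c" "e = a - b" for a b c
      using that hm(2) by (simp add: field_simps)
    ultimately show False using real unfolding e_def by blast
  qed
qed (simp_all add: Rep_ddf_inf Rep_ddf_minf)

lemma sibley_dist_self: "sibley_dist F F = 0"
proof (rule antisym)
  show "sibley_dist F F \<le> 0"
  proof (rule field_le_epsilon)
    fix e :: real assume e: "0 < e"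
    define h where "h = min e 1"
    have h: "0 < h" "h \<le> 1" "h \<le> e" using e by (auto simp: h_def)
    have "sibley_cond F F h"
      unfolding sibley_cond_def
    proof
      fix x :: real
      have "Rep_ddf F (ereal (x - h)) \<le> Rep_ddf F (ereal x)"
        "Rep_ddf F (ereal x) \<le> Rep_ddf F (ereal (x + h))"
        using h by (auto intro!: Rep_ddf_mono)
      then show "Rep_ddf F (ereal (x - h)) - h \<le> Rep_ddf F (ereal x) \<and>
          Rep_ddf F (ereal x) \<le> Rep_ddf F (ereal (x + h)) + h"
        using h by simp
    qed
    then have "h \<in> sibley_set F F" using h by (simp add: sibley_set_def)
    then show "sibley_dist F F \<le> 0 + e" using sibley_dist_le h(3) by fastforce
  qed
qed (rule sibley_dist_ge0)

instantiation ddf :: metric_space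
begin

definition dist_ddf :: "ddf \<Rightarrow> ddf \<Rightarrow> real"
  where "dist F G = sibley_dist F G"

definition uniformity_ddf :: "(ddf \<times> ddf) filter"
  where "uniformity = (INF e\<in>{0 <..}. principal {(F :: ddf, G). dist F G < e})"

definition open_ddf :: "ddf set \<Rightarrow> bool"
  where "open U \<longleftrightarrow> (\<forall>F\<in>U. \<forall>\<^sub>F (F', G) in uniformity. F' = F \<longrightarrow> G \<in> (U :: ddf set))"

instance
proof
  fix F G H :: ddf
  show "dist F G = 0 \<longleftrightarrow> F = G"
  proof
    assume "dist F G = 0"
    then have "sibley_dist F G = 0" "sibley_dist G F = 0"
      by (simp_all add: dist_ddf_def sibley_dist_commute)
    then show "F = G"
      by (intro order.antisym) (simp_all add: less_eq_ddf_def sibley_dist_0_le)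
  qed (simp add: dist_ddf_def sibley_dist_self)
  show "dist F G \<le> dist F H + dist G H"
    unfolding dist_ddf_def using sibley_dist_triangle[of F G H]
    by (simp add: sibley_dist_commute)
qed (rule uniformity_ddf_def open_ddf_def)+

end

section \<open>Triangle functions\<close>

definition triangle_function :: "(ddf \<Rightarrow> ddf \<Rightarrow> ddf) \<Rightarrow> bool"
  where "triangle_function \<tau> \<longleftrightarrow>
    (\<forall>F G H. \<tau> (\<tau> F G) H = \<tau> F (\<tau> G H)) \<and>
    (\<forall>F G. \<tau> F G = \<tau> G F) \<and>
    (\<forall>F F' G. F \<le> F' \<longrightarrow> \<tau> F G \<le> \<tau> F' G) \<and>
    (\<forall>F G G'. G \<le> G' \<longrightarrow> \<tau> F G \<le> \<tau> F G') \<and>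
    (\<forall>F. \<tau> eps0 F = F \<and> \<tau> F eps0 = F)"

definition continuous_triangle_function :: "(ddf \<Rightarrow> ddf \<Rightarrow> ddf) \<Rightarrow> bool"
  where "continuous_triangle_function \<tau> \<longleftrightarrow>
    triangle_function \<tau> \<and> continuous_on UNIV (\<lambda>(F, G). \<tau> F G)"

text \<open>A family enters only through the set \<open>S\<close> of its members.\<close>

definition sup_continuous_triangle :: "(ddf \<Rightarrow> ddf \<Rightarrow> ddf) \<Rightarrow> bool"
  where "sup_continuous_triangle \<tau> \<longleftrightarrow>
    (\<forall>S G. S \<noteq> {} \<longrightarrow> (SUP F\<in>S. \<tau> F G) = \<tau> (Sup S) G)"

section \<open>Probabilistic normed spaces\<close>

text \<open>A real linear space is a module, in the sense of HOL-Algebra, over the field of reals.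
  The multiplicative fields \<open>mult\<close> and \<open>one\<close> of the module record play no role.\<close>

definition real_field :: "real ring"
  where "real_field = \<lparr>carrier = UNIV, mult = (*), one = 1, zero = 0, add = (+)\<rparr>"

lemma field_real_field: "Ring.field real_field"
proof -
  have "\<exists>y. y + x = 0 \<and> x + y = 0" for x :: real
    by (rule exI[of _ "-x"]) simp
  then have "cring real_field"
    by unfold_locales (auto simp: real_field_def Units_def algebra_simps)
  then interpret cring real_field .
  show ?thesis
  proof (rule cring_fieldI2)
    fix a assume "a \<in> carrier real_field" "a \<noteq> \<zero>\<^bsub>real_field\<^esub>"
    then show "\<exists>b\<in>carrier real_field. a \<otimes>\<^bsub>real_field\<^esub> b = \<one>\<^bsub>real_field\<^esub>"
      by (intro bexI[of _ "inverse a"]) (auto simp: real_field_def)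
  qed (simp add: real_field_def)
qed

locale probabilistic_norm =
  Module.module real_field V for V :: "(real, 'v, 'm) module_scheme" (structure) +
  fixes \<nu> :: "'v \<Rightarrow> ddf" and \<tau> \<tau>' :: "ddf \<Rightarrow> ddf \<Rightarrow> ddf"
  assumes tau: "continuous_triangle_function \<tau>"
    and tau': "continuous_triangle_function \<tau>'"
    and tau_le: "\<tau> F G \<le> \<tau>' F G"
    and N2: "p \<in> carrier V \<Longrightarrow> \<nu> (\<ominus> p) = \<nu> p"
    and N3: "p \<in> carrier V \<Longrightarrow> q \<in> carrier V \<Longrightarrow> \<tau> (\<nu> p) (\<nu> q) \<le> \<nu> (p \<oplus> q)"
    and N4: "p \<in> carrier V \<Longrightarrow> \<alpha> \<in> {0..1} \<Longrightarrow> \<nu> p \<le> \<tau>' (\<nu> (\<alpha> \<odot> p)) (\<nu> ((1 - \<alpha>) \<odot> p))"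

locale PN_space = probabilistic_norm +
  assumes N1: "p \<in> carrier V \<Longrightarrow> \<nu> p = eps0 \<longleftrightarrow> p = \<zero>"

locale PPN_space = probabilistic_norm +
  assumes N1': "\<nu> \<zero> = eps0"

section \<open>Quotients by a linear subspace\<close>

definition subspace_rel :: "('k, 'v, 'm) module_scheme \<Rightarrow> 'v set \<Rightarrow> ('v \<times> 'v) set"
  where "subspace_rel V W =
    {(p, q). p \<in> carrier V \<and> q \<in> carrier V \<and> p \<ominus>\<^bsub>V\<^esub> q \<in> W}"

definition quotient_space :: "('k, 'v, 'm) module_scheme \<Rightarrow> 'v set \<Rightarrow> ('k, 'v set) module"
  where "quotient_space V W =
    \<lparr>carrier = carrier V // subspace_rel V W,
     mult = undefined, one = undefined,
     zero = subspace_rel V W `` {\<zero>\<^bsub>V\<^esub>},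
     add = (\<lambda>A B. \<Union>p\<in>A. \<Union>q\<in>B. subspace_rel V W `` {p \<oplus>\<^bsub>V\<^esub> q}),
     smult = (\<lambda>\<alpha> A. \<Union>p\<in>A. subspace_rel V W `` {\<alpha> \<odot>\<^bsub>V\<^esub> p})\<rparr>"

text \<open>The elements of the class \<open>p + W\<close> are exactly the \<open>p + q\<close> with \<open>q \<in> W\<close>; see
  \<open>Rep_quotient_nu\<close> below for the resulting formula.\<close>

definition quotient_nu :: "('v \<Rightarrow> ddf) \<Rightarrow> 'v set \<Rightarrow> ddf"
  where "quotient_nu \<nu> A = (SUP r\<in>A. \<nu> r)"

context
  fixes K :: "('k, 'n) ring_scheme" and V :: "('k, 'v, 'm) module_scheme" (structure) and W
  assumes mod: "Module.module K V" and sub: "submodule W K V"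
begin

interpretation V: Module.module K V by (rule mod)

lemmas subE = V.submoduleE[OF sub]

lemma W_carrier: "q \<in> W \<Longrightarrow> q \<in> carrier V"
  using subE(1) by blast

lemma equiv_subspace_rel: "equiv (carrier V) (subspace_rel V W)"
proof (rule equivI)
  show "subspace_rel V W \<subseteq> carrier V \<times> carrier V" by (auto simp: subspace_rel_def)
  obtain w where w: "w \<in> W" using subE(2) by blast
  then have "w \<oplus> \<ominus> w \<in> W" by (intro subE(3,5))
  then have "\<zero> \<in> W" using w by (simp add: V.M.r_neg W_carrier)
  then show "refl_on (carrier V) (subspace_rel V W)"
    by (auto simp: refl_on_def subspace_rel_def V.M.minus_eq V.M.r_neg)
  show "sym (subspace_rel V W)"
  proof (rule symI)
    fix p q assume pq: "(p, q) \<in> subspace_rel V W"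
    then have "\<ominus> (p \<ominus> q) \<in> W" using subE(3) by (auto simp: subspace_rel_def)
    moreover have "\<ominus> (p \<ominus> q) = q \<ominus> p"
      using pq by (simp add: subspace_rel_def V.M.minus_eq V.M.minus_add V.M.a_comm)
    ultimately show "(q, p) \<in> subspace_rel V W" using pq by (simp add: subspace_rel_def)
  qed
  show "trans (subspace_rel V W)"
  proof (rule transI)
    fix p q r assume pq: "(p, q) \<in> subspace_rel V W" and qr: "(q, r) \<in> subspace_rel V W"
    then have "(p \<ominus> q) \<oplus> (q \<ominus> r) \<in> W" using subE(5) by (auto simp: subspace_rel_def)
    moreover have "(p \<ominus> q) \<oplus> (q \<ominus> r) = p \<ominus> r"
      using pq qr by (simp add: subspace_rel_def V.M.minus_eq V.M.a_assoc V.M.r_neg1)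
    ultimately show "(p, r) \<in> subspace_rel V W"
      using pq qr by (simp add: subspace_rel_def)
  qed
qed

lemma subspace_rel_class:
  assumes p: "p \<in> carrier V"
  shows "subspace_rel V W `` {p} = (\<lambda>q. p \<oplus> q) ` W"
proof (intro equalityI subsetI)
  fix r assume r: "r \<in> subspace_rel V W `` {p}"
  then have rc: "r \<in> carrier V" and "p \<ominus> r \<in> W" by (auto simp: subspace_rel_def)
  then have "\<ominus> (p \<ominus> r) \<in> W" using subE(3) by blast
  moreover have "r = p \<oplus> \<ominus> (p \<ominus> r)"
    using p rc by (simp add: V.M.minus_eq V.M.minus_add V.M.r_neg2)
  ultimately show "r \<in> (\<lambda>q. p \<oplus> q) ` W" by blast
next
  fix r assume "r \<in> (\<lambda>q. p \<oplus> q) ` W"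
  then obtain q where q: "q \<in> W" "r = p \<oplus> q" by blast
  then have "p \<ominus> r = \<ominus> q"
    using p W_carrier by (simp add: V.M.minus_eq V.M.minus_add V.M.r_neg2)
  then show "r \<in> subspace_rel V W `` {p}"
    using p q subE(3) W_carrier by (auto simp: subspace_rel_def)
qed

lemma Rep_quotient_nu:
  assumes "p \<in> carrier V"
  shows "Rep_ddf (quotient_nu \<nu> (subspace_rel V W `` {p})) x = (SUP q\<in>W. Rep_ddf (\<nu> (p \<oplus> q)) x)"
  using subE(2) by (simp add: quotient_nu_def subspace_rel_class[OF assms] Rep_ddf_Sup image_image)

lemma add_quotient_space:
  assumes p: "p \<in> carrier V" and q: "q \<in> carrier V"
  shows "subspace_rel V W `` {p} \<oplus>\<^bsub>quotient_space V W\<^esub> subspace_rel V W `` {q}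
    = subspace_rel V W `` {p \<oplus> q}"
proof -
  have "subspace_rel V W `` {p'  \<oplus> q'} = subspace_rel V W `` {p \<oplus> q}"
    if "(p, p') \<in> subspace_rel V W" "(q, q') \<in> subspace_rel V W" for p' q'
  proof -
    have c: "p' \<in> carrier V" "q' \<in> carrier V" and "(p \<ominus> p') \<oplus> (q \<ominus> q') \<in> W"
      using that subE(5) by (auto simp: subspace_rel_def)
    moreover have "(p \<ominus> p') \<oplus> (q \<ominus> q') = (p \<oplus> q) \<ominus> (p' \<oplus> q')"
      using p q c by (simp add: V.M.minus_eq V.M.minus_add V.M.a_ac)
    ultimately have "(p \<oplus> q, p' \<oplus> q') \<in> subspace_rel V W"
      using p q by (simp add: subspace_rel_def)
    then show ?thesis using equiv_class_eq[OF equiv_subspace_rel] by blast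
  qed
  then have "(\<Union>p'\<in>subspace_rel V W `` {p}. \<Union>q'\<in>subspace_rel V W `` {q}.
        subspace_rel V W `` {p' \<oplus> q'})
      = (\<Union>p'\<in>subspace_rel V W `` {p}. \<Union>q'\<in>subspace_rel V W `` {q}.
        subspace_rel V W `` {p \<oplus> q})"
    by (intro SUP_cong refl) blast
  moreover have "p \<in> subspace_rel V W `` {p}" "q \<in> subspace_rel V W `` {q}"
    using equiv_class_self[OF equiv_subspace_rel] p q by blast+
  then have "subspace_rel V W `` {p} \<noteq> {}" "subspace_rel V W `` {q} \<noteq> {}"
    by blast+
  ultimately show ?thesis by (simp add: quotient_space_def)
qed

lemma smult_quotient_space:
  assumes a: "a \<in> carrier K" and p: "p \<in> carrier V"
  shows "a \<odot>\<^bsub>quotient_space V W\<^esub> (subspace_rel V W `` {p}) = subspace_rel V W `` {a \<odot> p}"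
proof -
  have "subspace_rel V W `` {a \<odot> p'} = subspace_rel V W `` {a \<odot> p}"
    if "(p, p') \<in> subspace_rel V W" for p'
  proof -
    have c: "p' \<in> carrier V" and "a \<odot> (p \<ominus> p') \<in> W"
      using that subE(4) a by (auto simp: subspace_rel_def)
    moreover have "a \<odot> (p \<ominus> p') = (a \<odot> p) \<ominus> (a \<odot> p')"
      using p c a by (simp add: V.M.minus_eq V.smult_r_distr V.smult_r_minus)
    ultimately have "(a \<odot> p, a \<odot> p') \<in> subspace_rel V W"
      using p a by (simp add: subspace_rel_def)
    then show ?thesis using equiv_class_eq[OF equiv_subspace_rel] by blast
  qed
  then have "(\<Union>p'\<in>subspace_rel V W `` {p}. subspace_rel V W `` {a \<odot> p'})
      = (\<Union>p'\<in>subspace_rel V W `` {p}. subspace_rel V W `` {a \<odot> p})"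
    by (intro SUP_cong refl) blast
  moreover have "subspace_rel V W `` {p} \<noteq> {}"
    using equiv_class_self[OF equiv_subspace_rel p] by blast
  ultimately show ?thesis by (simp add: quotient_space_def)
qed

end

end

theory Submission
  imports Defs
begin

text \<open>On the quotient, (N3) is where sup-continuity enters: \<open>\<tau>\<close> is moved inside the suprema over
  the two cosets, one argument at a time. (N4) only needs the monotonicity of \<open>\<tau>'\<close>, because
  scaling by \<open>\<alpha>\<close> maps \<open>p + W\<close> into \<open>\<alpha> p + W\<close>; and the null class has norm \<open>eps0\<close>
  because \<open>eps0\<close> is the largest distance distribution function.\<close>

text \<open>Monotonicity and the value 0 at 0 force \<open>F\<close> to vanish wherever
  \<open>eps0\<close> does; elsewhere \<open>eps0\<close> is already 1.\<close>

lemma ddf_le_eps0: "F \<le> eps0"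
  unfolding less_eq_ddf_def
proof
  fix x
  show "Rep_ddf F x \<le> Rep_ddf eps0 x"
    using Rep_ddf_mono[of x 0 F] Rep_ddf_le1[of F x] by (auto simp: eps0.rep_eq Rep_ddf_0)
qed

text \<open>\<open>Sup\<close> on \<open>ddf\<close> is only a syntactic instance, so its order laws
  are derived from the pointwise formula \<open>Rep_ddf_Sup\<close>, which requires a nonempty
  set.\<close>

lemma ddf_Sup_upper: "F \<in> S \<Longrightarrow> F \<le> (Sup S :: ddf)"
  unfolding less_eq_ddf_def
  by (subst Rep_ddf_Sup) (auto intro!: cSUP_upper bdd_above_Rep_ddf)

lemma ddf_Sup_least:
  assumes "S \<noteq> {}" and "\<And>F. F \<in> S \<Longrightarrow> F \<le> G"
  shows "Sup S \<le> (G :: ddf)"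
  using assms unfolding less_eq_ddf_def
  by (auto simp: Rep_ddf_Sup intro!: cSUP_least)

lemma triangle_function_mono:
  assumes "triangle_function \<tau>" "F \<le> F'" "G \<le> G'"
  shows "\<tau> F G \<le> \<tau> F' G'"
  using assms unfolding triangle_function_def by (meson order_trans)

text \<open>Sup-continuity speaks of the first argument only; commutativity carries it over to the
  second. This is the form in which it serves (N3).\<close>

lemma sup_continuous_triangle_SUP_le:
  assumes \<tau>: "triangle_function \<tau>" "sup_continuous_triangle \<tau>"
    and ne: "A \<noteq> {}" "B \<noteq> {}"
    and le: "\<And>F G. F \<in> A \<Longrightarrow> G \<in> B \<Longrightarrow> \<tau> F G \<le> H"
  shows "\<tau> (Sup A) (Sup B) \<le> H"
proof -
  have comm: "\<tau> F G = \<tau> G F" for F G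
    using \<tau>(1) unfolding triangle_function_def by blast
  have sup: "\<tau> (Sup S) G = (SUP F\<in>S. \<tau> F G)" if "S \<noteq> {}" for S G
    using \<tau>(2) that unfolding sup_continuous_triangle_def by metis
  have "\<tau> F (Sup B) \<le> H" if "F \<in> A" for F
    using ne(2) le[OF that] by (auto simp: comm[of F] sup intro!: ddf_Sup_least)
  then show ?thesis
    using ne(1) by (auto simp: sup intro!: ddf_Sup_least)
qed

text \<open>Every element of the quotient is a class \<open>c p\<close>, and the operations reduce
  to representatives, so each axiom is the image of the same axiom in \<open>V\<close>.\<close>

lemma module_quotient_space:
  fixes K :: "('k, 'n) ring_scheme" and V :: "('k, 'v, 'm) module_scheme" (structure)
  assumes mod: "Module.module K V" and sub: "submodule W K V"
  shows "Module.module K (quotient_space V W)"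
proof -
  interpret V: Module.module K V by (rule mod)
  let ?Q = "quotient_space V W"
  define c where "c p = subspace_rel V W `` {p}" for p
  have carrierQ: "carrier ?Q = c ` carrier V"
    by (auto simp: quotient_space_def quotient_def c_def)
  have zeroQ: "\<zero>\<^bsub>?Q\<^esub> = c \<zero>"
    by (simp add: quotient_space_def c_def)
  have addQ: "c p \<oplus>\<^bsub>?Q\<^esub> c q = c (p \<oplus> q)" if "p \<in> carrier V" "q \<in> carrier V" for p q
    using add_quotient_space[OF mod sub that] by (simp add: c_def)
  have smultQ: "a \<odot>\<^bsub>?Q\<^esub> c p = c (a \<odot> p)" if "a \<in> carrier K" "p \<in> carrier V" for a p
    using smult_quotient_space[OF mod sub that] by (simp add: c_def)
  have "abelian_group ?Q"
  proof (rule abelian_groupI)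
    fix x assume "x \<in> carrier ?Q"
    then obtain p where p: "p \<in> carrier V" "x = c p" by (auto simp: carrierQ)
    then have "c (\<ominus> p) \<oplus>\<^bsub>?Q\<^esub> x = \<zero>\<^bsub>?Q\<^esub>"
      by (simp add: addQ zeroQ V.M.l_neg)
    then show "\<exists>y\<in>carrier ?Q. y \<oplus>\<^bsub>?Q\<^esub> x = \<zero>\<^bsub>?Q\<^esub>"
      using p by (auto simp: carrierQ)
  qed (auto simp: carrierQ zeroQ addQ V.M.a_ac)
  then show ?thesis
    by (intro moduleI V.R.is_cring)
      (auto simp: carrierQ addQ smultQ V.smult_l_distr V.smult_r_distr V.smult_assoc1)
qed

text \<open>Negation is not a field of the record but is derived from \<open>add\<close> and
  \<open>zero\<close>, so it is found by uniqueness of inverses. (N2) on the quotient depends on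
  it.\<close>

lemma a_inv_quotient_space:
  fixes V :: "('k, 'v, 'm) module_scheme" (structure)
  assumes mod: "Module.module K V" and sub: "submodule W K V" and p: "p \<in> carrier V"
  shows "\<ominus>\<^bsub>quotient_space V W\<^esub> (subspace_rel V W `` {p}) = subspace_rel V W `` {\<ominus> p}"
proof -
  interpret V: Module.module K V by (rule mod)
  interpret Q: Module.module K "quotient_space V W" by (rule module_quotient_space[OF mod sub])
  have "subspace_rel V W `` {q} \<in> carrier (quotient_space V W)" if "q \<in> carrier V" for q
    using that by (auto simp: quotient_space_def quotient_def)
  moreover have "subspace_rel V W `` {\<ominus> p} \<oplus>\<^bsub>quotient_space V W\<^esub> subspace_rel V W `` {p}
      = \<zero>\<^bsub>quotient_space V W\<^esub>"
    \<comment> \<open>The definition is unfolded only in the second pass, since doing so earlier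
      would destroy the left side of \<open>add_quotient_space\<close>.\<close>
    using p by (simp add: add_quotient_space[OF mod sub] V.M.l_neg) (simp add: quotient_space_def)
  ultimately show ?thesis
    using p by (intro Q.M.minus_equality) auto
qed

lemma PN_space_submodule:
  fixes V :: "(real, 'v, 'm) module_scheme" (structure)
  assumes "PN_space V \<nu> \<tau> \<tau>'" and sub: "submodule W real_field V"
  shows "PN_space (V\<lparr>carrier := W\<rparr>) (restrict \<nu> W) \<tau> \<tau>'"
proof -
  interpret PN_space V \<nu> \<tau> \<tau>' by fact
  note W = submoduleE[OF sub]
  interpret W: Module.module real_field "V\<lparr>carrier := W\<rparr>"
    by (rule submodule.submodule_is_module[OF sub]) unfold_locales
  \<comment> \<open>Unlike \<open>add\<close>, \<open>zero\<close> and \<open>smult\<close>,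
    negation depends on the carrier, so its agreement on \<open>W\<close> needs an argument.\<close>
  have inv: "\<ominus>\<^bsub>V\<lparr>carrier := W\<rparr>\<^esub> p = \<ominus> p" if "p \<in> W" for p
    using that W(1,3) by (intro W.M.minus_equality) (auto simp: M.l_neg)
  have "\<zero> \<in> W" using W.M.zero_closed by simp
  show ?thesis
    \<comment> \<open>Closure of \<open>W\<close> keeps every argument inside \<open>W\<close>,
      where \<open>restrict\<close> agrees with \<nu>.\<close>
    by unfold_locales
      (use W \<open>\<zero> \<in> W\<close> in \<open>auto simp: inv tau tau' tau_le real_field_def
        subset_iff intro: N2 N3 N4 iffD1[OF N1] iffD2[OF N1]\<close>)
qed

text \<open>Only a pseudo norm can be expected: for a dense \<open>W\<close>, say, a coset other
  than \<open>W\<close> may have supremum \<open>eps0\<close> although no member attains it.\<close>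

lemma PPN_space_quotient_space:
  fixes V :: "(real, 'v, 'm) module_scheme" (structure)
  assumes "PN_space V \<nu> \<tau> \<tau>'" and sup: "sup_continuous_triangle \<tau>"
    and sub: "submodule W real_field V"
  shows "PPN_space (quotient_space V W) (quotient_nu \<nu>) \<tau> \<tau>'"
proof -
  interpret PN_space V \<nu> \<tau> \<tau>' by fact
  have mod: "Module.module real_field V" by unfold_locales
  let ?Q = "quotient_space V W"
  interpret Q: Module.module real_field ?Q by (rule module_quotient_space[OF mod sub])
  note W = submoduleE[OF sub]
  have tri: "triangle_function \<tau>" "triangle_function \<tau>'"
    using tau tau' by (auto simp: continuous_triangle_function_def)
  have W_carrier: "q \<in> carrier V" if "q \<in> W" for q using that W(1) by blast
  define c where "c p = subspace_rel V W `` {p}" for p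
  have c: "c p = (\<lambda>q. p \<oplus> q) ` W" if "p \<in> carrier V" for p
    unfolding c_def by (rule subspace_rel_class[OF mod sub that])
  have carrierE: thesis if "A \<in> carrier ?Q" "\<And>p. p \<in> carrier V \<Longrightarrow> A = c p \<Longrightarrow> thesis" for A thesis
    using that by (auto simp: quotient_space_def quotient_def c_def)
  have c_ne: "c p \<noteq> {}" if "p \<in> carrier V" for p using c[OF that] W(2) by simp
  have c_carrier: "r \<in> carrier V" if "p \<in> carrier V" "r \<in> c p" for p r
    using that c W_carrier by auto
  have upper: "\<nu> r \<le> quotient_nu \<nu> A" if "r \<in> A" for r A
    unfolding quotient_nu_def using that by (intro ddf_Sup_upper) blast
  have least: "quotient_nu \<nu> (c p) \<le> F" if "p \<in> carrier V" "\<And>r. r \<in> c p \<Longrightarrow> \<nu> r \<le> F" for p F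
    unfolding quotient_nu_def using that c_ne by (intro ddf_Sup_least) auto
  have inv_c: "\<ominus> r \<in> c (\<ominus> p)" if "p \<in> carrier V" "r \<in> c p" for p r
    using that c W(3) by (auto simp: M.minus_add W_carrier)
  have add_c: "r \<oplus> s \<in> c (p \<oplus> q)"
    if pq: "p \<in> carrier V" "q \<in> carrier V" and rs: "r \<in> c p" "s \<in> c q" for p q r s
  proof -
    obtain u v where uv: "u \<in> W" "v \<in> W" "r = p \<oplus> u" "s = q \<oplus> v"
      using pq rs c by auto
    then have "r \<oplus> s = (p \<oplus> q) \<oplus> (u \<oplus> v)"
      using pq W_carrier by (simp add: M.a_ac)
    then show ?thesis using c pq W(5) uv by auto
  qed
  \<comment> \<open>The inclusion may be proper: for \<alpha> = 0 the coset shrinks to the null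
    vector. Membership is all that (N4) needs.\<close>
  have smult_c: "\<alpha> \<odot> r \<in> c (\<alpha> \<odot> p)" if "p \<in> carrier V" "r \<in> c p" for \<alpha> p r
  proof -
    have \<alpha>: "\<alpha> \<in> carrier real_field" by (simp add: real_field_def)
    show ?thesis using that c \<alpha> W(4) by (auto simp: smult_r_distr W_carrier)
  qed
  show ?thesis
  proof unfold_locales
    show "continuous_triangle_function \<tau>" "continuous_triangle_function \<tau>'" by (fact tau tau')+
    show "\<tau> F G \<le> \<tau>' F G" for F G by (rule tau_le)
    have "\<zero> \<in> c \<zero>" using equiv_class_self[OF equiv_subspace_rel[OF mod sub]] by (simp add: c_def)
    then have "eps0 \<le> quotient_nu \<nu> (c \<zero>)" using upper N1[of \<zero>] by fastforce
    then have "quotient_nu \<nu> (c \<zero>) = eps0" by (intro order.antisym ddf_le_eps0)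
    then show "quotient_nu \<nu> \<zero>\<^bsub>?Q\<^esub> = eps0" by (simp add: quotient_space_def c_def)
  next
    fix A assume "A \<in> carrier ?Q"
    then obtain p where p: "p \<in> carrier V" "A = c p" by (rule carrierE)
    \<comment> \<open>Negation sends the coset of \<open>p\<close> into that of
      \<open>\<ominus> p\<close> and preserves \<nu>. Using this for both \<open>p\<close> and
      \<open>\<ominus> p\<close> gives equality.\<close>
    have le: "quotient_nu \<nu> (c p) \<le> quotient_nu \<nu> (c (\<ominus> p))" if "p \<in> carrier V" for p
      using that inv_c upper N2 c_carrier by (intro least) metis+
    have "\<ominus>\<^bsub>?Q\<^esub> A = c (\<ominus> p)"
      using p a_inv_quotient_space[OF mod sub] by (simp add: c_def)
    then show "quotient_nu \<nu> (\<ominus>\<^bsub>?Q\<^esub> A) = quotient_nu \<nu> A"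
      using le[of p] le[of "\<ominus> p"] p by (auto intro: order.antisym)
  next
    fix A B assume "A \<in> carrier ?Q" "B \<in> carrier ?Q"
    then obtain p q where p: "p \<in> carrier V" "A = c p" and q: "q \<in> carrier V" "B = c q"
      by (metis carrierE)
    have "\<tau> (\<nu> r) (\<nu> s) \<le> quotient_nu \<nu> (c (p \<oplus> q))" if "r \<in> c p" "s \<in> c q" for r s
      using N3[of r s] upper[OF add_c[OF p(1) q(1) that]] c_carrier p(1) q(1) that
      by (meson order_trans)
    then have "\<tau> (quotient_nu \<nu> A) (quotient_nu \<nu> B) \<le> quotient_nu \<nu> (c (p \<oplus> q))"
      \<comment> \<open>The instances open only the two suprema inside \<tau>; the right side stays
        folded as the common bound \<open>H\<close>.\<close>
      unfolding p q quotient_nu_def[of \<nu> "c p"] quotient_nu_def[of \<nu> "c q"]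
      using c_ne p(1) q(1) by (intro sup_continuous_triangle_SUP_le[OF tri(1) sup]) auto
    also have "c (p \<oplus> q) = A \<oplus>\<^bsub>?Q\<^esub> B"
      using p q add_quotient_space[OF mod sub] by (simp add: c_def)
    finally show "\<tau> (quotient_nu \<nu> A) (quotient_nu \<nu> B) \<le> quotient_nu \<nu> (A \<oplus>\<^bsub>?Q\<^esub> B)" .
  next
    fix A and \<alpha> :: real assume "A \<in> carrier ?Q" and \<alpha>: "\<alpha> \<in> {0..1}"
    then obtain p where p: "p \<in> carrier V" "A = c p" by (metis carrierE)
    have smult: "\<beta> \<odot>\<^bsub>?Q\<^esub> A = c (\<beta> \<odot> p)" for \<beta>
      using p smult_quotient_space[OF mod sub] by (simp add: c_def real_field_def)
    show "quotient_nu \<nu> A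
        \<le> \<tau>' (quotient_nu \<nu> (\<alpha> \<odot>\<^bsub>?Q\<^esub> A)) (quotient_nu \<nu> ((1 - \<alpha>) \<odot>\<^bsub>?Q\<^esub> A))"
      \<comment> \<open>The order matters: \<open>smult\<close> is stated for \<open>A\<close>, so
        \<open>A\<close> may be replaced by \<open>c p\<close> only afterwards.\<close>
      unfolding smult unfolding p(2)
    proof (rule least[OF p(1)])
      fix r assume r: "r \<in> c p"
      have "\<nu> r \<le> \<tau>' (\<nu> (\<alpha> \<odot> r)) (\<nu> ((1 - \<alpha>) \<odot> r))"
        using N4 c_carrier p(1) r \<alpha> by blast
      also have "\<dots> \<le> \<tau>' (quotient_nu \<nu> (c (\<alpha> \<odot> p))) (quotient_nu \<nu> (c ((1 - \<alpha>) \<odot> p)))"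
        using p(1) r by (intro triangle_function_mono[OF tri(2)] upper smult_c)
      finally show "\<nu> r \<le> \<dots>" .
    qed
  qed
qed

theorem proposition3p3:
  fixes V :: "(real, 'v, 'm) module_scheme"
    and \<nu> :: "'v \<Rightarrow> ddf"
    and \<tau> \<tau>' :: "ddf \<Rightarrow> ddf \<Rightarrow> ddf"
    and W :: "'v set"
  assumes "PN_space V \<nu> \<tau> \<tau>'"
    and "sup_continuous_triangle \<tau>"
    and "sup_continuous_triangle \<tau>'"
    and "submodule W real_field V"
  shows "PN_space (V\<lparr>carrier := W\<rparr>) (restrict \<nu> W) \<tau> \<tau>' \<and>
    PPN_space (quotient_space V W) (quotient_nu \<nu>) \<tau> \<tau>'"
  using assms PN_space_submodule PPN_space_quotient_space by blast

end
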